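(* Let $P_1,\dots,P_k$ be pairwise disjoint sets of primes, and let $v_1,\dots,v_k$ be sequences of elements of $[0,1]$ such that $v_j$ is polyadicly continuous with respect to $P_j$ for $j=1,\dots,k$. Then $v_1,\dots,v_k$ are statistically independent.
   Context: For a set $P$ of primes, $S(P)$ is the multiplicative semigroup generated by $P$. A sequence $v$ is polyadicly continuous with respect to $P$ if for every $\varepsilon>0$ there is $m\in S(P)$ such that $n_1\equiv n_2\pmod m$ implies $|v(n_1)-v(n_2)|<\varepsilon$ for all $n_1,n_2\in\mathbb N$. $E_N(w)=\frac1N\sum_{n=1}^Nw(n)$. Sequences $v_1,\dots,v_k$ in $[0,1]$ are statistically independent if for all continuous $g_1,\dots,g_k$ on $[0,1]$, with $u=g_1(v_1)\cdots g_k(v_k)$ (termwise), $E_N(u)-E_N(g_1(v_1))\cdots E_N(g_k(v_k))\to0$ as $N\to\infty$. *)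

theory Defs
  imports "HOL-Analysis.Analysis" "HOL-Number_Theory.Cong"
begin

text \<open>
  Sequences are functions on \<^typ>\<open>nat\<close> of which only the values at indices \<open>n \<ge> 1\<close>
  are ever used.
\<close>

text \<open>
  The unit 1 (the empty product) is included. This matters only for the empty set of
  generators, where it makes exactly the constant sequences polyadicly continuous.
\<close>

inductive_set gen_semigroup :: "nat set \<Rightarrow> nat set" for P :: "nat set" where
  unit: "1 \<in> gen_semigroup P"
| gen: "p \<in> P \<Longrightarrow> p \<in> gen_semigroup P"
| mult: "a \<in> gen_semigroup P \<Longrightarrow> b \<in> gen_semigroup P \<Longrightarrow> a * b \<in> gen_semigroup P"

definition polyadicly_continuous :: "nat set \<Rightarrow> (nat \<Rightarrow> real) \<Rightarrow> bool" where
  "polyadicly_continuous P v \<longleftrightarrow>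
     (\<forall>\<epsilon>>0. \<exists>m\<in>gen_semigroup P. \<forall>n1\<ge>1. \<forall>n2\<ge>1.
        [n1 = n2] (mod m) \<longrightarrow> \<bar>v n1 - v n2\<bar> < \<epsilon>)"

definition seq_mean :: "nat \<Rightarrow> (nat \<Rightarrow> real) \<Rightarrow> real" where
  "seq_mean N w = (\<Sum>n=1..N. w n) / real N"

definition statistically_independent :: "nat \<Rightarrow> (nat \<Rightarrow> nat \<Rightarrow> real) \<Rightarrow> bool" where
  "statistically_independent k v \<longleftrightarrow>
     (\<forall>g :: nat \<Rightarrow> real \<Rightarrow> real. (\<forall>j\<in>{1..k}. continuous_on {0..1} (g j)) \<longrightarrow>
        (\<lambda>N. seq_mean N (\<lambda>n. \<Prod>j=1..k. g j (v j n))
              - (\<Prod>j=1..k. seq_mean N (\<lambda>n. g j (v j n)))) \<longlonglongrightarrow> 0)"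

end

theory Submission
  imports Defs
begin

text \<open>
  A sequence that is polyadicly continuous with respect to \<open>P\<close> is a uniform limit of sequences
  with periods in the semigroup generated by \<open>P\<close>. For disjoint sets of primes the periods are
  coprime, so by the Chinese remainder theorem the mean of a product of two periodic sequences is
  the product of the means. This passes to uniform limits, and since the
  product of two polyadicly continuous sequences is polyadicly continuous with respect to the union
  of the sets of primes, more than two factors can be split off one at a time.
\<close>

section \<open>Generated semigroups\<close>

lemma gen_semigroup_mono:
  assumes "P \<subseteq> Q"
  shows "gen_semigroup P \<subseteq> gen_semigroup Q"
proof
  fix a assume "a \<in> gen_semigroup P"
  then show "a \<in> gen_semigroup Q"
    by induction (use assms in \<open>auto intro: gen_semigroup.intros simp del: One_nat_def\<close>)
qed

text \<open>Primality keeps 0 out of the semigroup. This matters since congruence modulo 0 is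
  equality and would give no period.\<close>

lemma gen_semigroup_pos:
  assumes "\<And>p. p \<in> P \<Longrightarrow> prime p" and "a \<in> gen_semigroup P"
  shows "a > 0"
  using assms(2) by induction (use assms(1) in \<open>auto intro: prime_gt_0_nat\<close>)

text \<open>Being coprime to a fixed number is preserved by products, so two nested inductions
  reduce the claim to two generators. These are distinct primes because \<open>P\<close> and
  \<open>Q\<close> are disjoint.\<close>

lemma gen_semigroup_coprime:
  assumes "\<And>p. p \<in> P \<Longrightarrow> prime p" and "\<And>q. q \<in> Q \<Longrightarrow> prime q" and "P \<inter> Q = {}"
    and "a \<in> gen_semigroup P" and "b \<in> gen_semigroup Q"
  shows "coprime a b"
  using assms(4)
proof induction
  case (gen p)
  from assms(5) show ?case
  proof induction
    case (gen q)
    with \<open>p \<in> P\<close> assms(1-3) show ?case by (metis disjoint_iff primes_coprime)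
  qed auto
qed auto

section \<open>Means of periodic sequences\<close>

lemma seq_mean_diff: "seq_mean N f - seq_mean N g = seq_mean N (\<lambda>n. f n - g n)"
  by (simp add: seq_mean_def sum_subtractf diff_divide_distrib)

lemma abs_seq_mean_le:
  assumes "\<And>n. n \<ge> 1 \<Longrightarrow> \<bar>f n\<bar> \<le> C" and "C \<ge> 0"
  shows "\<bar>seq_mean N f\<bar> \<le> C"
proof (cases "N = 0")
  case False
  have "\<bar>\<Sum>n=1..N. f n\<bar> \<le> (\<Sum>n=1..N. C)"
    by (rule order.trans[OF sum_abs sum_mono]) (use assms in auto)
  then show ?thesis
    using False by (simp add: seq_mean_def divide_le_eq mult.commute)
qed (use assms(2) in \<open>simp add: seq_mean_def\<close>)

lemma periodic_mod:
  fixes f :: "nat \<Rightarrow> 'a"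
  assumes "\<And>n. f (n + m) = f n"
  shows "f n = f (n mod m)"
proof -
  have "f (a + b * m) = f a" for a b
  proof (induction b)
    case (Suc b)
    with assms[of "a + b * m"] show ?case by (simp add: ac_simps)
  qed simp
  from this[of "n mod m" "n div m"] show ?thesis by simp
qed

lemma periodic_bounded:
  fixes f :: "nat \<Rightarrow> real"
  assumes "m > 0" and "\<And>n. f (n + m) = f n"
  obtains C where "\<And>n. \<bar>f n\<bar> \<le> C"
proof
  fix n
  have "\<bar>f n\<bar> = \<bar>f (n mod m)\<bar>"
    by (subst periodic_mod[of f m, OF assms(2)]) simp
  also have "\<dots> \<le> Max ((\<lambda>i. \<bar>f i\<bar>) ` {..<m})"
    using assms(1) by (intro Max_ge) auto
  finally show "\<bar>f n\<bar> \<le> Max ((\<lambda>i. \<bar>f i\<bar>) ` {..<m})" .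
qed

text \<open>Subtracting the linear growth \<open>N * a\<close> from the partial sums leaves a
  periodic, hence bounded, function of \<open>N\<close>, which vanishes in the limit after division
  by \<open>N\<close>.\<close>

lemma seq_mean_periodic:
  assumes "m > 0" and per: "\<And>n. u (n + m) = u n"
  shows "(\<lambda>N. seq_mean N u) \<longlonglongrightarrow> (\<Sum>n<m. u n) / real m"
proof -
  define a where "a = (\<Sum>n<m. u n) / real m"
  define f where "f N = (\<Sum>n=1..N. u n) - real N * a" for N
  have block: "(\<Sum>n=1..N+m. u n) = (\<Sum>n=1..N. u n) + (\<Sum>n<m. u n)" for N
  proof (induction N)
    case 0
    \<comment> \<open>The sums over \<open>{1..m}\<close> and \<open>{..<m}\<close> differ only in
      having \<open>u m\<close> in place of \<open>u 0\<close>. With these end terms added the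
      identity holds for every sequence; periodicity then cancels them.\<close>
    have "(\<Sum>n=1..m. u n) + u 0 = (\<Sum>n<m. u n) + u m"
      by (induction m) auto
    with per[of 0] show ?case by simp
  next
    case (Suc N)
    with per[of "Suc N"] show ?case by simp
  qed
  have "f (N + m) = f N" for N
    using block[of N] \<open>m > 0\<close> by (simp add: f_def a_def field_simps)
  then obtain C where C: "\<And>N. \<bar>f N\<bar> \<le> C"
    using periodic_bounded[OF \<open>m > 0\<close>, of f] by blast
  have "(\<lambda>N. inverse (real N) * f N) \<longlonglongrightarrow> 0"
    by (rule lim_null_mult_right_bounded[where B = C])
      (use C lim_inverse_n in \<open>auto\<close>)
  moreover have "\<forall>\<^sub>F N in sequentially. inverse (real N) * f N = seq_mean N u - a"
    using eventually_gt_at_top[of 0]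
    by eventually_elim (simp add: f_def seq_mean_def field_simps)
  ultimately have "(\<lambda>N. seq_mean N u - a) \<longlonglongrightarrow> 0"
    by (simp add: tendsto_cong)
  then show ?thesis
    unfolding a_def by (simp add: LIM_zero_iff)
qed

text \<open>By the Chinese remainder theorem, the residues of \<open>n\<close> modulo
  \<open>a\<close> and modulo \<open>b\<close> run through all pairs exactly once as
  \<open>n\<close> runs through a period \<open>a * b\<close>, so the sum becomes a double sum that
  factors.\<close>

lemma sum_periodic_mult:
  fixes f g :: "nat \<Rightarrow> real"
  assumes "coprime a b" and "a > 0" and "b > 0"
    and "\<And>n. f (n + a) = f n" and "\<And>n. g (n + b) = g n"
  shows "(\<Sum>n<a*b. f n * g n) = (\<Sum>n<a. f n) * (\<Sum>n<b. g n)"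
proof -
  define h where "h n = (n mod a, n mod b)" for n
  have inj: "inj_on h {..<a*b}"
  proof (rule inj_onI)
    fix x y assume xy: "x \<in> {..<a*b}" "y \<in> {..<a*b}" "h x = h y"
    then have "[x = y] (mod a * b)"
      using assms(1) by (intro coprime_cong_mult_nat) (auto simp: h_def cong_def)
    with xy show "x = y" by (simp add: cong_def)
  qed
  have "h ` {..<a*b} \<subseteq> {..<a} \<times> {..<b}"
    using assms(2,3) by (auto simp: h_def)
  \<comment> \<open>Surjectivity comes from counting: the injective image has \<open>a * b\<close>
    elements, as many as the product set.\<close>
  then have "h ` {..<a*b} = {..<a} \<times> {..<b}"
    by (intro card_subset_eq) (simp_all add: card_image[OF inj])
  with inj have bij: "bij_betw h {..<a*b} ({..<a} \<times> {..<b})"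
    by (simp add: bij_betw_def)
  have "(\<Sum>n<a*b. f n * g n) = (\<Sum>n<a*b. case h n of (i, j) \<Rightarrow> f i * g j)"
    by (simp add: h_def flip: periodic_mod[of f a, OF assms(4)] periodic_mod[of g b, OF assms(5)])
  also have "\<dots> = (\<Sum>(i, j)\<in>{..<a} \<times> {..<b}. f i * g j)"
    by (rule sum.reindex_bij_betw[OF bij])
  also have "\<dots> = (\<Sum>n<a. f n) * (\<Sum>n<b. g n)"
    by (simp add: sum_product sum.cartesian_product)
  finally show ?thesis .
qed

lemma seq_mean_periodic_mult:
  assumes "coprime a b" and "a > 0" and "b > 0"
    and f: "\<And>n. f (n + a) = f n" and g: "\<And>n. g (n + b) = g n"
  shows "(\<lambda>N. seq_mean N (\<lambda>n. f n * g n) - seq_mean N f * seq_mean N g) \<longlonglongrightarrow> 0"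
proof -
  have "f (n + a * b) = f n" "g (n + a * b) = g n" for n
    by (metis mod_mult_self2 periodic_mod[of f a, OF f])
      (metis mod_mult_self3 add.commute periodic_mod[of g b, OF g])
  then have "(\<lambda>N. seq_mean N (\<lambda>n. f n * g n)) \<longlonglongrightarrow> (\<Sum>n<a*b. f n * g n) / real (a * b)"
    using assms by (intro seq_mean_periodic) auto
  moreover have "(\<lambda>N. seq_mean N f * seq_mean N g)
      \<longlonglongrightarrow> ((\<Sum>n<a. f n) / real a) * ((\<Sum>n<b. g n) / real b)"
    by (intro tendsto_mult seq_mean_periodic assms)
  ultimately show ?thesis
    using sum_periodic_mult[of a b f g] assms by (auto dest: tendsto_diff)
qed

section \<open>Polyadicly continuous sequences\<close>

lemma polyadicly_continuousD:
  assumes "polyadicly_continuous P w" and "\<epsilon> > 0"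
  obtains m where "m \<in> gen_semigroup P"
    and "\<And>n1 n2. n1 \<ge> 1 \<Longrightarrow> n2 \<ge> 1 \<Longrightarrow> [n1 = n2] (mod m) \<Longrightarrow> \<bar>w n1 - w n2\<bar> < \<epsilon>"
  using assms unfolding polyadicly_continuous_def by meson

text \<open>Shifting the representative \<open>n mod m\<close> by \<open>m\<close> keeps the index positive.\<close>

lemma polyadicly_continuous_periodic_approx:
  assumes "polyadicly_continuous P w" and "\<And>p. p \<in> P \<Longrightarrow> prime p" and "\<epsilon> > 0"
  obtains m where "m \<in> gen_semigroup P" and "m > 0"
    and "\<And>n. n \<ge> 1 \<Longrightarrow> \<bar>w n - w (n mod m + m)\<bar> < \<epsilon>"
proof -
  obtain m where m: "m \<in> gen_semigroup P"
    and close: "\<And>n1 n2. n1 \<ge> 1 \<Longrightarrow> n2 \<ge> 1 \<Longrightarrow> [n1 = n2] (mod m) \<Longrightarrow> \<bar>w n1 - w n2\<bar> < \<epsilon>"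
    using polyadicly_continuousD assms(1,3) by blast
  have "m > 0" using gen_semigroup_pos assms(2) m by blast
  then have "\<bar>w n - w (n mod m + m)\<bar> < \<epsilon>" if "n \<ge> 1" for n
    using that by (intro close) (auto simp: cong_def)
  with m \<open>m > 0\<close> that show thesis by blast
qed

text \<open>The sequence stays within 1 of a periodic one, which takes finitely many values. Index 0
  is left out because continuity says nothing about it.\<close>

lemma polyadicly_continuous_bounded:
  assumes "polyadicly_continuous P w" and "\<And>p. p \<in> P \<Longrightarrow> prime p"
  obtains C where "C > 0" and "\<And>n. n \<ge> 1 \<Longrightarrow> \<bar>w n\<bar> \<le> C"
proof -
  obtain m where m: "m > 0" "\<And>n. n \<ge> 1 \<Longrightarrow> \<bar>w n - w (n mod m + m)\<bar> < 1"
    using polyadicly_continuous_periodic_approx[OF assms, of 1] by auto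
  obtain B where B: "\<And>n. \<bar>w (n mod m + m)\<bar> \<le> B"
    using periodic_bounded[OF m(1), of "\<lambda>n. w (n mod m + m)"] by auto
  have "\<bar>w n\<bar> \<le> B + 1" if "n \<ge> 1" for n
    using m(2)[OF that] B[of n] by linarith
  moreover have "B + 1 > 0" using B[of 0] by linarith
  ultimately show thesis using that by blast
qed

text \<open>The mixed product \<open>c * b\<close> is inserted between \<open>a * b\<close> and
  \<open>c * d\<close>, so that only one factor changes at a time.\<close>

lemma abs_mult_diff_le:
  fixes a b c d :: real
  assumes "\<bar>b\<bar> \<le> B" and "\<bar>c\<bar> \<le> C" and "\<bar>a - c\<bar> \<le> \<epsilon>" and "\<bar>b - d\<bar> \<le> \<epsilon>"
  shows "\<bar>a * b - c * d\<bar> \<le> \<epsilon> * (B + C)"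
proof -
  have "\<bar>a * b - c * d\<bar> = \<bar>(a - c) * b + c * (b - d)\<bar>"
    by (simp add: algebra_simps)
  also have "\<dots> \<le> \<bar>a - c\<bar> * \<bar>b\<bar> + \<bar>c\<bar> * \<bar>b - d\<bar>"
    by (metis abs_mult abs_triangle_ineq)
  also have "\<dots> \<le> \<epsilon> * B + C * \<epsilon>"
    by (intro add_mono mult_mono) (use assms in auto)
  finally show ?thesis by (simp add: algebra_simps)
qed

text \<open>The modulus 1 serves for every \<open>P\<close>, even the empty set; this starts the
  induction over finite products.\<close>

lemma polyadicly_continuous_const: "polyadicly_continuous P (\<lambda>n. c)"
  unfolding polyadicly_continuous_def by (auto intro: gen_semigroup.unit)

lemma polyadicly_continuous_mult:
  assumes w: "polyadicly_continuous P w" and P: "\<And>p. p \<in> P \<Longrightarrow> prime p"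
    and z: "polyadicly_continuous Q z" and Q: "\<And>q. q \<in> Q \<Longrightarrow> prime q"
  shows "polyadicly_continuous (P \<union> Q) (\<lambda>n. w n * z n)"
  unfolding polyadicly_continuous_def
proof (intro allI impI)
  fix \<epsilon> :: real assume "\<epsilon> > 0"
  obtain B where B: "B > 0" "\<And>n. n \<ge> 1 \<Longrightarrow> \<bar>w n\<bar> \<le> B"
    using polyadicly_continuous_bounded[OF w P] by auto
  obtain C where C: "C > 0" "\<And>n. n \<ge> 1 \<Longrightarrow> \<bar>z n\<bar> \<le> C"
    using polyadicly_continuous_bounded[OF z Q] by auto
  \<comment> \<open>The product estimate is not strict; the factor 2 leaves
    \<open>\<epsilon> / 2\<close> and so restores strictness.\<close>
  define \<delta> where "\<delta> = \<epsilon> / (2 * (C + B))"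
  have "\<delta> > 0" using \<open>\<epsilon> > 0\<close> B C by (simp add: \<delta>_def)
  obtain a where a: "a \<in> gen_semigroup P"
    "\<And>n1 n2. n1 \<ge> 1 \<Longrightarrow> n2 \<ge> 1 \<Longrightarrow> [n1 = n2] (mod a) \<Longrightarrow> \<bar>w n1 - w n2\<bar> < \<delta>"
    using polyadicly_continuousD[OF w \<open>\<delta> > 0\<close>] by blast
  obtain b where b: "b \<in> gen_semigroup Q"
    "\<And>n1 n2. n1 \<ge> 1 \<Longrightarrow> n2 \<ge> 1 \<Longrightarrow> [n1 = n2] (mod b) \<Longrightarrow> \<bar>z n1 - z n2\<bar> < \<delta>"
    using polyadicly_continuousD[OF z \<open>\<delta> > 0\<close>] by blast
  have "a * b \<in> gen_semigroup (P \<union> Q)"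
    using a(1) b(1) gen_semigroup_mono[of P "P \<union> Q"] gen_semigroup_mono[of Q "P \<union> Q"]
    by (auto intro: gen_semigroup.mult)
  moreover have "\<bar>w n1 * z n1 - w n2 * z n2\<bar> < \<epsilon>"
    if n: "n1 \<ge> 1" "n2 \<ge> 1" "[n1 = n2] (mod a * b)" for n1 n2
  proof -
    \<comment> \<open>A congruence modulo \<open>a * b\<close> implies the congruences modulo
      \<open>a\<close> and modulo \<open>b\<close>.\<close>
    have "\<bar>w n1 - w n2\<bar> < \<delta>" "\<bar>z n1 - z n2\<bar> < \<delta>"
      using n cong_modulus_mult_nat[of n1 n2 a b] cong_modulus_mult_nat[of n1 n2 b a]
      by (simp_all add: a(2) b(2) mult.commute)
    then have "\<bar>w n1 * z n1 - w n2 * z n2\<bar> \<le> \<delta> * (C + B)"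
      using B C n by (intro abs_mult_diff_le) auto
    also have "\<dots> = \<epsilon> / 2" using B(1) C(1) by (simp add: \<delta>_def field_simps)
    finally show ?thesis using \<open>\<epsilon> > 0\<close> by simp
  qed
  ultimately show "\<exists>m\<in>gen_semigroup (P \<union> Q). \<forall>n1\<ge>1. \<forall>n2\<ge>1.
      [n1 = n2] (mod m) \<longrightarrow> \<bar>w n1 * z n1 - w n2 * z n2\<bar> < \<epsilon>" by blast
qed

lemma polyadicly_continuous_prod:
  assumes "finite A" and "\<And>j. j \<in> A \<Longrightarrow> polyadicly_continuous (P j) (w j)"
    and "\<And>j p. j \<in> A \<Longrightarrow> p \<in> P j \<Longrightarrow> prime p"
  shows "polyadicly_continuous (\<Union>j\<in>A. P j) (\<lambda>n. \<Prod>j\<in>A. w j n)"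
  using assms
proof (induction A)
  case empty
  show ?case by (simp add: polyadicly_continuous_const)
next
  case (insert i A)
  then have "polyadicly_continuous (\<Union>j\<in>A. P j) (\<lambda>n. \<Prod>j\<in>A. w j n)"
    by blast
  with insert.prems
  have "polyadicly_continuous (P i \<union> (\<Union>j\<in>A. P j)) (\<lambda>n. w i n * (\<Prod>j\<in>A. w j n))"
    by (intro polyadicly_continuous_mult) blast+
  with insert.hyps show ?case by simp
qed

text \<open>Continuity of \<open>g\<close> must be uniform because one \<open>\<delta>\<close>, and
  hence one modulus, has to serve all values of \<open>v\<close> at once.\<close>

lemma polyadicly_continuous_compose:
  assumes v: "polyadicly_continuous P v" and "\<And>n. n \<ge> 1 \<Longrightarrow> v n \<in> S"
    and "uniformly_continuous_on S g"
  shows "polyadicly_continuous P (\<lambda>n. g (v n))"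
  unfolding polyadicly_continuous_def
proof (intro allI impI)
  fix \<epsilon> :: real assume "\<epsilon> > 0"
  then obtain \<delta> where "\<delta> > 0"
    and \<delta>: "\<And>x y. x \<in> S \<Longrightarrow> y \<in> S \<Longrightarrow> \<bar>x - y\<bar> < \<delta> \<Longrightarrow> \<bar>g x - g y\<bar> < \<epsilon>"
    using assms(3) unfolding uniformly_continuous_on_def dist_real_def
    by (metis abs_minus_commute)
  obtain m where "m \<in> gen_semigroup P"
    "\<And>n1 n2. n1 \<ge> 1 \<Longrightarrow> n2 \<ge> 1 \<Longrightarrow> [n1 = n2] (mod m) \<Longrightarrow> \<bar>v n1 - v n2\<bar> < \<delta>"
    using polyadicly_continuousD[OF v \<open>\<delta> > 0\<close>] by blast
  then show "\<exists>m\<in>gen_semigroup P. \<forall>n1\<ge>1. \<forall>n2\<ge>1.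
      [n1 = n2] (mod m) \<longrightarrow> \<bar>g (v n1) - g (v n2)\<bar> < \<epsilon>"
    using \<delta> assms(2) by blast
qed

section \<open>Independence\<close>

lemma polyadicly_continuous_seq_mean_mult:
  assumes w: "polyadicly_continuous P w" and P: "\<And>p. p \<in> P \<Longrightarrow> prime p"
    and z: "polyadicly_continuous Q z" and Q: "\<And>q. q \<in> Q \<Longrightarrow> prime q"
    and "P \<inter> Q = {}"
  shows "(\<lambda>N. seq_mean N (\<lambda>n. w n * z n) - seq_mean N w * seq_mean N z) \<longlonglongrightarrow> 0"
proof (rule LIMSEQ_I)
  fix \<epsilon> :: real assume "\<epsilon> > 0"
  obtain B where B: "B > 0" "\<And>n. n \<ge> 1 \<Longrightarrow> \<bar>w n\<bar> \<le> B"
    using polyadicly_continuous_bounded[OF w P] by auto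
  obtain C where C: "C > 0" "\<And>n. n \<ge> 1 \<Longrightarrow> \<bar>z n\<bar> \<le> C"
    using polyadicly_continuous_bounded[OF z Q] by auto
  \<comment> \<open>Passing to the periodic approximations costs at most
    \<open>\<epsilon> / 4\<close> in the mean of the product and as much in the product of the
    means. The periodic sequences themselves are allowed an error below
    \<open>\<epsilon> / 2\<close>.\<close>
  define \<delta> where "\<delta> = \<epsilon> / (4 * (C + B))"
  have "\<delta> > 0" using \<open>\<epsilon> > 0\<close> B C by (simp add: \<delta>_def)
  have \<delta>: "\<delta> * (C + B) = \<epsilon> / 4" using B(1) C(1) by (simp add: \<delta>_def field_simps)
  obtain a where a: "a \<in> gen_semigroup P" "a > 0"
    "\<And>n. n \<ge> 1 \<Longrightarrow> \<bar>w n - w (n mod a + a)\<bar> < \<delta>"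
    using polyadicly_continuous_periodic_approx[OF w P \<open>\<delta> > 0\<close>] by auto
  obtain b where b: "b \<in> gen_semigroup Q" "b > 0"
    "\<And>n. n \<ge> 1 \<Longrightarrow> \<bar>z n - z (n mod b + b)\<bar> < \<delta>"
    using polyadicly_continuous_periodic_approx[OF z Q \<open>\<delta> > 0\<close>] by auto
  define f where "f n = w (n mod a + a)" for n
  define g where "g n = z (n mod b + b)" for n
  \<comment> \<open>Since \<open>a > 0\<close>, the index \<open>n mod a + a\<close> is positive for
    every \<open>n\<close>, so \<open>f\<close> inherits the bound of \<open>w\<close>.\<close>
  have f: "\<bar>f n\<bar> \<le> B" for n using B(2)[of "n mod a + a"] a(2) by (simp add: f_def)
  have "coprime a b"
    using gen_semigroup_coprime[OF P Q \<open>P \<inter> Q = {}\<close> a(1) b(1)] by simp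
  then have "(\<lambda>N. seq_mean N (\<lambda>n. f n * g n) - seq_mean N f * seq_mean N g) \<longlonglongrightarrow> 0"
    using a(2) b(2) by (intro seq_mean_periodic_mult[of a b]) (simp_all add: f_def g_def)
  then obtain M where
    M: "\<And>N. N \<ge> M \<Longrightarrow> \<bar>seq_mean N (\<lambda>n. f n * g n) - seq_mean N f * seq_mean N g\<bar> < \<epsilon> / 2"
    using LIMSEQ_D[of _ 0 "\<epsilon> / 2"] \<open>\<epsilon> > 0\<close> by fastforce
  have "\<bar>seq_mean N (\<lambda>n. w n * z n) - seq_mean N w * seq_mean N z\<bar> < \<epsilon>" if "N \<ge> M" for N
  proof -
    have "\<bar>w n * z n - f n * g n\<bar> \<le> \<epsilon> / 4" if "n \<ge> 1" for n
      unfolding \<delta>[symmetric]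
      by (intro abs_mult_diff_le) (use a(3)[of n] b(3)[of n] C f that in \<open>auto simp: f_def g_def\<close>)
    then have 1: "\<bar>seq_mean N (\<lambda>n. w n * z n) - seq_mean N (\<lambda>n. f n * g n)\<bar> \<le> \<epsilon> / 4"
      unfolding seq_mean_diff using \<open>\<epsilon> > 0\<close> by (intro abs_seq_mean_le) auto
    have "\<bar>seq_mean N w - seq_mean N f\<bar> \<le> \<delta>" "\<bar>seq_mean N z - seq_mean N g\<bar> \<le> \<delta>"
      unfolding seq_mean_diff f_def g_def
      using less_imp_le[OF a(3)] less_imp_le[OF b(3)] \<open>\<delta> > 0\<close>
      by (auto intro!: abs_seq_mean_le)
    moreover have "\<bar>seq_mean N z\<bar> \<le> C" "\<bar>seq_mean N f\<bar> \<le> B"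
      using B C f by (auto intro!: abs_seq_mean_le)
    ultimately have "\<bar>seq_mean N w * seq_mean N z - seq_mean N f * seq_mean N g\<bar> \<le> \<epsilon> / 4"
      unfolding \<delta>[symmetric] by (intro abs_mult_diff_le)
    with 1 M[OF \<open>N \<ge> M\<close>] show ?thesis by linarith
  qed
  then show "\<exists>M. \<forall>N\<ge>M.
      norm (seq_mean N (\<lambda>n. w n * z n) - seq_mean N w * seq_mean N z - 0) < \<epsilon>" by auto
qed

text \<open>The factor \<open>w i\<close> is split off from the product of the others, which is
  polyadicly continuous with respect to the union of their prime sets. That union is disjoint from
  \<open>P i\<close>, so the case of two factors applies.\<close>

lemma polyadicly_continuous_seq_mean_prod:
  assumes "finite A" and "\<And>j. j \<in> A \<Longrightarrow> polyadicly_continuous (P j) (w j)"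
    and "\<And>j p. j \<in> A \<Longrightarrow> p \<in> P j \<Longrightarrow> prime p" and "disjoint_family_on P A"
  shows "(\<lambda>N. seq_mean N (\<lambda>n. \<Prod>j\<in>A. w j n) - (\<Prod>j\<in>A. seq_mean N (w j))) \<longlonglongrightarrow> 0"
  using assms
proof (induction A)
  case empty
  \<comment> \<open>Only eventually: at \<open>N = 0\<close> the mean is 0 by the convention for
    division by zero.\<close>
  have "\<forall>\<^sub>F N in sequentially. seq_mean N (\<lambda>n. 1) - 1 = 0"
    using eventually_gt_at_top[of 0] by eventually_elim (simp add: seq_mean_def)
  then show ?case by (simp add: tendsto_eventually)
next
  case (insert i A)
  let ?R = "\<lambda>n. \<Prod>j\<in>A. w j n"
  have disj: "P i \<inter> (\<Union>j\<in>A. P j) = {}" and "disjoint_family_on P A"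
    using insert.prems(3) insert.hyps(2) by (auto simp: disjoint_family_on_insert)
  with insert have IH: "(\<lambda>N. seq_mean N ?R - (\<Prod>j\<in>A. seq_mean N (w j))) \<longlonglongrightarrow> 0"
    by blast
  have cont: "polyadicly_continuous (P i) (w i)" and P: "\<And>p. p \<in> P i \<Longrightarrow> prime p"
    using insert.prems(1,2) by auto
  have "polyadicly_continuous (\<Union>j\<in>A. P j) ?R"
    using insert.hyps(1) insert.prems(1,2) by (intro polyadicly_continuous_prod) blast+
  then have split:
    "(\<lambda>N. seq_mean N (\<lambda>n. w i n * ?R n) - seq_mean N (w i) * seq_mean N ?R) \<longlonglongrightarrow> 0"
    using insert.prems(2) cont disj
    by (intro polyadicly_continuous_seq_mean_mult[where P = "P i" and Q = "\<Union>j\<in>A. P j"]) blast+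
  obtain C where "C > 0" "\<And>n. n \<ge> 1 \<Longrightarrow> \<bar>w i n\<bar> \<le> C"
    using polyadicly_continuous_bounded[OF cont P] by auto
  then have "\<bar>seq_mean N (w i)\<bar> \<le> C" for N
    by (intro abs_seq_mean_le) auto
  \<comment> \<open>The error for the remaining factors tends to 0, and it is multiplied by means
    bounded by \<open>C\<close>.\<close>
  then have "(\<lambda>N. seq_mean N (w i) * (seq_mean N ?R - (\<Prod>j\<in>A. seq_mean N (w j)))) \<longlonglongrightarrow> 0"
    by (intro lim_null_mult_left_bounded[where B = C] IH) auto
  \<comment> \<open>In the sum of the two null sequences the term
    \<open>seq_mean N (w i) * seq_mean N ?R\<close> cancels.\<close>
  from tendsto_add[OF split this] insert.hyps show ?case
    by (simp add: algebra_simps)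
qed

theorem theorem6:
  fixes k :: nat and P :: "nat \<Rightarrow> nat set" and v :: "nat \<Rightarrow> nat \<Rightarrow> real"
  assumes "\<And>j p. j \<in> {1..k} \<Longrightarrow> p \<in> P j \<Longrightarrow> prime p"
    and "disjoint_family_on P {1..k}"
    and "\<And>j n. j \<in> {1..k} \<Longrightarrow> n \<ge> 1 \<Longrightarrow> v j n \<in> {0..1}"
    and "\<And>j. j \<in> {1..k} \<Longrightarrow> polyadicly_continuous (P j) (v j)"
  shows "statistically_independent k v"
  unfolding statistically_independent_def
proof (intro allI impI)
  fix g :: "nat \<Rightarrow> real \<Rightarrow> real"
  assume g: "\<forall>j\<in>{1..k}. continuous_on {0..1} (g j)"
  \<comment> \<open>Compactness of the unit interval makes each \<open>g j\<close> uniformly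
    continuous, so composing with it preserves polyadic continuity.\<close>
  have "polyadicly_continuous (P j) (\<lambda>n. g j (v j n))" if "j \<in> {1..k}" for j
  proof (rule polyadicly_continuous_compose[where S = "{0..1}" and v = "v j" and g = "g j"])
    show "uniformly_continuous_on {0..1} (g j)"
      using g that by (intro compact_uniformly_continuous) auto
  qed (use assms(3,4) that in blast)+
  then show "(\<lambda>N. seq_mean N (\<lambda>n. \<Prod>j=1..k. g j (v j n))
      - (\<Prod>j=1..k. seq_mean N (\<lambda>n. g j (v j n)))) \<longlonglongrightarrow> 0"
    using assms(1,2) by (intro polyadicly_continuous_seq_mean_prod[where P = P]) blast+
qed

end
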